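(* Let $n_x,n_r,n_b$ be positive integers with $n_r<n_x$. Let $Q\in\mathbb{R}^{n_x\times n_x}$ be diagonal and positive definite, let $S\in\mathbb{R}^{n_r\times n_x}$ and $W_b\in\mathbb{R}^{n_r\times n_b}$ have full row rank, let $\mathcal{T}_x\in\mathbb{R}^{n_x\times n_x}$ and $\mathcal{T}_\nu\in\mathbb{R}^{n_r\times n_r}$ be diagonal and positive definite, and let $t_b,t_c\ge 0$. Consider the input-output saddle-point system $G$ with state $(x,\nu)\in\mathbb{R}^{n_x}\times\mathbb{R}^{n_r}$, input $(\eta_c,\eta_b)\in\mathbb{R}^{n_x}\times\mathbb{R}^{n_b}$ and output $z\in\mathbb{R}^{n_x}$ given by $$\mathcal{T}_x\dot x=-Qx-S^{\sf T}\nu-t_c\,\eta_c,\qquad \mathcal{T}_\nu\dot\nu=Sx-t_b W_b\,\eta_b,\qquad z=Q^{1/2}x$$ (so that $\|z(t)\|_2^2=x(t)^{\sf T}Qx(t)$). Then the squared $\mathcal{H}_2$ norm of this system is $$\|G\|_{\mathcal{H}_2}^2=\frac{t_c^2}{2}\,\mathrm{Tr}\big(\mathcal{T}_x^{-1}\big)+\frac{t_b^2}{2}\,\mathrm{Tr}\big(W_b^{\sf T}\mathcal{T}_\nu^{-1}W_b\big).$$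
   Context: For an LTI system $\dot\xi=A\xi+B\eta$, $z=C\xi$ with $A$ Hurwitz, the $\mathcal{H}_2$ norm from $\eta$ to $z$ is defined by $\|G\|_{\mathcal{H}_2}^2=\frac{1}{2\pi}\int_{-\infty}^{\infty}\mathrm{Tr}\big(G(-j\omega)^{\sf T}G(j\omega)\big)\,d\omega$ with $G(j\omega)=C(j\omega I-A)^{-1}B$. Equivalently, $\|G\|_{\mathcal{H}_2}^2=\mathrm{Tr}(B^{\sf T}XB)$, where $X=X^{\sf T}\succeq 0$ is the unique solution of $A^{\sf T}X+XA+C^{\sf T}C=0$. The system models the continuous-time saddle-point (primal-dual) algorithm for minimizing $\frac12x^{\sf T}Qx+c^{\sf T}x$ subject to $Sx=W_bb$, with disturbances $b\mapsto b+t_b\eta_b$, $c\mapsto c+t_c\eta_c$, written in error coordinates with respect to the optimizer. *)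

theory Defs
  imports "HOL-Analysis.Analysis"
begin

section \<open>Matrices\<close>

definition diagonal_matrix :: "real^'n^'n \<Rightarrow> bool" where
  "diagonal_matrix M \<longleftrightarrow> (\<forall>i j. i \<noteq> j \<longrightarrow> M $ i $ j = 0)"

definition pos_semidef :: "real^'n^'n \<Rightarrow> bool" where
  "pos_semidef M \<longleftrightarrow> transpose M = M \<and> (\<forall>v. 0 \<le> v \<bullet> (M *v v))"

definition pos_def :: "real^'n^'n \<Rightarrow> bool" where
  "pos_def M \<longleftrightarrow> transpose M = M \<and> (\<forall>v. v \<noteq> 0 \<longrightarrow> 0 < v \<bullet> (M *v v))"

definition full_row_rank :: "real^'n^'m \<Rightarrow> bool" where
  "full_row_rank M \<longleftrightarrow> rank M = CARD('m)"

text \<open>The principal square root; it is meaningful only for positive semidefinite \<open>M\<close>.\<close>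

definition mat_sqrt :: "real^'n^'n \<Rightarrow> real^'n^'n" where
  "mat_sqrt M = (THE R. pos_semidef R \<and> R ** R = M)"

definition complex_matrix :: "real^'n^'m \<Rightarrow> complex^'n^'m" where
  "complex_matrix M = map_matrix complex_of_real M"

definition block_matrix ::
  "'a^'p^'m \<Rightarrow> 'a^'q^'m \<Rightarrow> 'a^'p^'n \<Rightarrow> 'a^'q^'n \<Rightarrow> 'a^('p + 'q)^('m + 'n)" where
  "block_matrix M11 M12 M21 M22 =
     (\<chi> i j. case i of
        Inl k \<Rightarrow> (case j of Inl l \<Rightarrow> M11 $ k $ l | Inr l \<Rightarrow> M12 $ k $ l)
      | Inr k \<Rightarrow> (case j of Inl l \<Rightarrow> M21 $ k $ l | Inr l \<Rightarrow> M22 $ k $ l))"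

definition block_row :: "'a^'p^'m \<Rightarrow> 'a^'q^'m \<Rightarrow> 'a^('p + 'q)^'m" where
  "block_row M1 M2 = (\<chi> i j. case j of Inl l \<Rightarrow> M1 $ i $ l | Inr l \<Rightarrow> M2 $ i $ l)"

definition block_vector :: "'a^'p \<Rightarrow> 'a^'q \<Rightarrow> 'a^('p + 'q)" where
  "block_vector u v = (\<chi> i. case i of Inl k \<Rightarrow> u $ k | Inr k \<Rightarrow> v $ k)"


section \<open>The H2 norm of an LTI system\<close>

definition hurwitz :: "real^'n^'n \<Rightarrow> bool" where
  "hurwitz A \<longleftrightarrow>
     (\<forall>(l::complex) v. v \<noteq> 0 \<and> complex_matrix A *v v = l *s v \<longrightarrow> Re l < 0)"

definition transfer_function ::
  "real^'n^'n \<Rightarrow> real^'m^'n \<Rightarrow> real^'n^'p \<Rightarrow> complex \<Rightarrow> complex^'m^'p" where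
  "transfer_function A B C s =
     complex_matrix C ** matrix_inv (mat s - complex_matrix A) ** complex_matrix B"

text \<open>
  The value is kept complex: that the trace integral is real is part of what an equation
  with a real right-hand side asserts. The definition is meaningful for Hurwitz \<open>A\<close>;
  then \<open>mat (\<i> * \<omega>) - complex_matrix A\<close> is invertible for every real \<open>\<omega>\<close>, and the
  integrand is integrable.
\<close>

definition h2_norm_squared ::
  "real^'n^'n \<Rightarrow> real^'m^'n \<Rightarrow> real^'n^'p \<Rightarrow> complex" where
  "h2_norm_squared A B C =
     1 / (2 * complex_of_real pi) *
       (LINT \<omega>|lborel.
          trace (transpose (transfer_function A B C (- (\<i> * complex_of_real \<omega>)))
                 ** transfer_function A B C (\<i> * complex_of_real \<omega>)))"


section \<open>The saddle-point system\<close>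

text \<open>
  The system \<open>Tx x' = - Q x - S\<^sup>T \<nu> - tc \<eta>c\<close>, \<open>Tnu \<nu>' = S x - tb Wb \<eta>b\<close>, \<open>z = Q\<^sup>1\<^sup>/\<^sup>2 x\<close> in the
  state-space form \<open>\<xi>' = A \<xi> + B \<eta>\<close>, \<open>z = C \<xi>\<close> with \<open>\<xi> = (x, \<nu>)\<close> and \<open>\<eta> = (\<eta>c, \<eta>b)\<close>.
\<close>

definition saddle_A ::
  "real^'x^'x \<Rightarrow> real^'x^'r \<Rightarrow> real^'x^'x \<Rightarrow> real^'r^'r \<Rightarrow> real^('x + 'r)^('x + 'r)" where
  "saddle_A Q S Tx Tnu =
     block_matrix (- (matrix_inv Tx ** Q)) (- (matrix_inv Tx ** transpose S))
                  (matrix_inv Tnu ** S)    0"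

definition saddle_B ::
  "real^'b^'r \<Rightarrow> real^'x^'x \<Rightarrow> real^'r^'r \<Rightarrow> real \<Rightarrow> real \<Rightarrow> real^('x + 'b)^('x + 'r)" where
  "saddle_B Wb Tx Tnu tc tb =
     block_matrix (- (tc *\<^sub>R matrix_inv Tx)) 0
                  0                         (- (tb *\<^sub>R (matrix_inv Tnu ** Wb)))"

definition saddle_C :: "real^'x^'x \<Rightarrow> real^('x + 'r::finite)^'x" where
  "saddle_C Q = block_row (mat_sqrt Q) 0"

lemma UNIV_sum_split:
  "sum f (UNIV :: ('p::finite + 'q::finite) set) = (\<Sum>k\<in>UNIV. f (Inl k)) + (\<Sum>k\<in>UNIV. f (Inr k))"
  by (simp add: UNIV_Plus_UNIV [symmetric] sum.Plus del: UNIV_Plus_UNIV)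

lemma block_matrix_mult_vector:
  "block_matrix M11 M12 M21 M22 *v block_vector u v =
     block_vector (M11 *v u + M12 *v v) (M21 *v u + M22 *v v)"
  by (auto simp: vec_eq_iff matrix_vector_mult_def block_matrix_def block_vector_def
      UNIV_sum_split split: sum.split)

lemma block_row_mult_vector:
  "block_row M1 M2 *v block_vector u v = M1 *v u + M2 *v v"
  by (simp add: vec_eq_iff matrix_vector_mult_def block_row_def block_vector_def UNIV_sum_split)

lemma block_vector_add:
  "block_vector u v + block_vector u' v' = block_vector (u + u') (v + v')"
  by (simp add: vec_eq_iff block_vector_def split: sum.split)

lemma block_vector_eq_iff:
  "block_vector u v = block_vector u' v' \<longleftrightarrow> u = u' \<and> v = v'"
proof
  assume eq: "block_vector u v = block_vector u' v'"
  have "u $ i = u' $ i" for i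
    using arg_cong [OF eq, of "\<lambda>w. w $ Inl i"] by (simp add: block_vector_def)
  moreover have "v $ i = v' $ i" for i
    using arg_cong [OF eq, of "\<lambda>w. w $ Inr i"] by (simp add: block_vector_def)
  ultimately show "u = u' \<and> v = v'" by (simp add: vec_eq_iff)
qed simp

lemma invertible_matrix_inv_right:
  fixes T :: "real^'n^'n"
  assumes "invertible T"
  shows "T ** matrix_inv T = mat 1"
  using someI_ex [OF assms [unfolded invertible_def]] by (simp add: matrix_inv_def)

lemma invertible_mult_eq_iff:
  fixes T :: "real^'n^'n"
  assumes "invertible T"
  shows "u = matrix_inv T *v w \<longleftrightarrow> T *v u = w"
proof -
  have "matrix_inv T ** T = mat 1"
    using someI_ex [OF assms [unfolded invertible_def]] by (simp add: matrix_inv_def)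
  with invertible_matrix_inv_right [OF assms] show ?thesis
    by (metis matrix_vector_mul_assoc matrix_vector_mul_lid)
qed

lemma uminus_matrix_vector_mult: "(- M :: real^'n^'m) *v u = - (M *v u)"
  by (simp add: vec_eq_iff matrix_vector_mult_def sum_negf)

lemma saddle_dynamics_iff:
  assumes "invertible Tx" "invertible Tnu"
  shows "block_vector dx dnu =
           saddle_A Q S Tx Tnu *v block_vector x nu
           + saddle_B Wb Tx Tnu tc tb *v block_vector etac etab
         \<longleftrightarrow> Tx *v dx = - (Q *v x) - transpose S *v nu - tc *\<^sub>R etac
           \<and> Tnu *v dnu = S *v x - tb *\<^sub>R (Wb *v etab)"
proof -
  have "saddle_A Q S Tx Tnu *v block_vector x nu
          + saddle_B Wb Tx Tnu tc tb *v block_vector etac etab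
        = block_vector (matrix_inv Tx *v (- (Q *v x) - transpose S *v nu - tc *\<^sub>R etac))
                       (matrix_inv Tnu *v (S *v x - tb *\<^sub>R (Wb *v etab)))"
    by (simp add: saddle_A_def saddle_B_def block_matrix_mult_vector block_vector_add
        block_vector_eq_iff uminus_matrix_vector_mult matrix_vector_mul_assoc [symmetric]
        scaleR_matrix_vector_assoc [symmetric] matrix_vector_mult_diff_distrib
        linear_neg [OF matrix_vector_mul_linear] matrix_vector_mult_scaleR)
  then show ?thesis
    using assms by (simp add: block_vector_eq_iff invertible_mult_eq_iff)
qed

lemma pos_def_diagonal_pos:
  assumes "pos_def Q"
  shows "0 < Q $ i $ i"
proof -
  have "0 < axis i 1 \<bullet> (Q *v axis i 1)"
    using assms by (simp add: pos_def_def axis_eq_0_iff)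
  then show ?thesis
    by (simp add: inner_axis' matrix_vector_mult_basis column_def)
qed

lemma mat_sqrt_diagonal:
  assumes "diagonal_matrix Q" "pos_def Q"
  shows "mat_sqrt Q = (\<chi> i j. if i = j then sqrt (Q $ i $ i) else 0)"
    and "pos_semidef (mat_sqrt Q)" and "mat_sqrt Q ** mat_sqrt Q = Q"
proof -
  define D :: "real^'a^'a" where "D = (\<chi> i j. if i = j then sqrt (Q $ i $ i) else 0)"
  have Qpos: "0 < Q $ i $ i" for i
    using pos_def_diagonal_pos [OF assms(2)] .
  have Dv: "(D *v v) $ i = sqrt (Q $ i $ i) * v $ i" for v i
    by (simp add: D_def matrix_vector_mult_def if_distrib [of "\<lambda>x. x * _"] cong: if_cong)
  have D_psd: "pos_semidef D"
    unfolding pos_semidef_def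
  proof
    show "transpose D = D" by (simp add: D_def transpose_def vec_eq_iff)
    have "v $ i * (sqrt (Q $ i $ i) * v $ i) \<ge> 0" for v :: "real^'a" and i
      using less_imp_le [OF Qpos [of i]] by (simp add: mult.left_commute [of "v $ i"])
    then show "\<forall>v. 0 \<le> v \<bullet> (D *v v)"
      by (auto simp: inner_vec_def Dv intro!: sum_nonneg)
  qed
  have D_sq: "D ** D = Q"
    using Qpos assms(1)
    by (auto simp: vec_eq_iff matrix_matrix_mult_def D_def diagonal_matrix_def less_imp_le
        if_distrib [of "\<lambda>x. x * _"] cong: if_cong)
  have unique: "R = D" if R: "pos_semidef R" "R ** R = Q" for R
  proof -
    have "R *v axis i 1 = D *v axis i 1" for i
    proof -
      define e :: "real^'a" where "e = axis i 1"
      define d where "d = sqrt (Q $ i $ i)"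
      define w where "w = R *v e - d *\<^sub>R e"
      have d: "0 < d" using Qpos by (simp add: d_def)
      have De: "D *v e = d *\<^sub>R e"
        by (auto simp: vec_eq_iff Dv e_def d_def axis_def)
      have "R *v (R *v e) = D *v (D *v e)"
        using R(2) D_sq by (simp add: matrix_vector_mul_assoc)
      then have "R *v w = - (d *\<^sub>R w)"
        by (simp add: w_def De matrix_vector_mult_diff_distrib matrix_vector_mult_scaleR
            scaleR_diff_right)
      moreover have "0 \<le> w \<bullet> (R *v w)" using R(1) by (simp add: pos_semidef_def)
      ultimately have "d * (w \<bullet> w) \<le> 0" by simp
      then have "w \<bullet> w \<le> 0" using d by (simp add: mult_le_0_iff)
      then have "w = 0" by (simp add: antisym_conv)
      then show ?thesis by (simp add: w_def De e_def [symmetric])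
    qed
    then have "column i R = column i D" for i
      by (simp add: matrix_vector_mult_basis)
    then show ?thesis by (simp add: column_def vec_eq_iff)
  qed
  have root: "mat_sqrt Q = D"
    unfolding mat_sqrt_def
  proof (rule the_equality)
    show "pos_semidef D \<and> D ** D = Q" using D_psd D_sq ..
    show "\<And>R. pos_semidef R \<and> R ** R = Q \<Longrightarrow> R = D" using unique by blast
  qed
  show "mat_sqrt Q = (\<chi> i j. if i = j then sqrt (Q $ i $ i) else 0)"
    unfolding root by (rule D_def)
  show "pos_semidef (mat_sqrt Q)" unfolding root by (rule D_psd)
  show "mat_sqrt Q ** mat_sqrt Q = Q" unfolding root by (rule D_sq)
qed

lemma saddle_output: "saddle_C Q *v block_vector x nu = mat_sqrt Q *v x"
  by (simp add: saddle_C_def block_row_mult_vector)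

lemma saddle_output_norm:
  assumes "diagonal_matrix Q" "pos_def Q"
  shows "(norm (saddle_C Q *v block_vector x nu))\<^sup>2 = x \<bullet> (Q *v x)"
proof -
  have "transpose (mat_sqrt Q) = mat_sqrt Q"
    using mat_sqrt_diagonal(2) [OF assms] by (simp only: pos_semidef_def)
  then have "(mat_sqrt Q *v x) \<bullet> (mat_sqrt Q *v x) = x \<bullet> (mat_sqrt Q *v (mat_sqrt Q *v x))"
    by (metis dot_lmul_matrix transpose_matrix_vector)
  then have "(norm (mat_sqrt Q *v x))\<^sup>2 = x \<bullet> (mat_sqrt Q *v (mat_sqrt Q *v x))"
    by (simp only: power2_norm_eq_inner)
  also have "\<dots> = x \<bullet> (Q *v x)"
    using mat_sqrt_diagonal(3) [OF assms] by (simp add: matrix_vector_mul_assoc)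
  finally show ?thesis by (simp add: saddle_output)
qed

end

theory Submission
  imports Defs "HOL-Complex_Analysis.Complex_Analysis" "HOL-Probability.Sinc_Integral"
begin

text \<open>
  The matrix \<open>X = diag (Tx, Tnu) / 2\<close> solves the Lyapunov equation
  \<open>A\<^sup>T X + X A + C\<^sup>T C = 0\<close>, because the skew coupling of the saddle-point dynamics cancels, and
  \<open>tr (B\<^sup>T X B)\<close> is the claimed value. Stability follows from the same equation: an eigenvector for
  an eigenvalue outside the open left half plane would be unobservable, which the full row rank
  of \<open>S\<close> excludes.

  To evaluate the frequency integral, write \<open>R s = (s I - A)\<^sup>-\<^sup>1\<close> and
  \<open>C\<^sup>T C = (- s I - A)\<^sup>T X + X (s I - A)\<close>. The integrand becomes \<open>F s + F (- s)\<close> at \<open>s = \<i> \<omega>\<close>, with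
  \<open>F s = tr (B B\<^sup>T X R s)\<close>. Since \<open>F\<close> is holomorphic on the closed right half plane and
  \<open>F s = c / s + O (1 / s\<^sup>2)\<close> with \<open>c = tr (B\<^sup>T X B)\<close>, Cauchy's theorem on the triangle with vertices
  \<open>- \<i> R\<close>, \<open>R\<close>, \<open>\<i> R\<close> shows that \<open>F s\<close> may be replaced by \<open>c / (s + 1)\<close>, whose symmetrization
  \<open>2 c / (1 + \<omega>\<^sup>2)\<close> integrates to \<open>2 \<pi> c\<close>.
\<close>

section \<open>Integrals along the imaginary axis\<close>

text \<open>The axis segment is one side of a triangle inside the half plane, so Cauchy's theorem
  trades it for the two slanted sides. Those stay at distance at least \<open>R / 2\<close> from the
  origin and have length at most \<open>2 * R\<close>, which costs \<open>8 * K / R\<close> each. A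
  triangle suits a closed half plane: its hull stays inside, and no neighbourhood of the axis is
  involved.\<close>

lemma half_plane_contour_integral_bound:
  assumes holo: "h holomorphic_on {s. 0 \<le> Re s}"
    and decay: "\<And>s. 0 \<le> Re s \<Longrightarrow> r \<le> norm s \<Longrightarrow> norm (h s) \<le> K / (norm s)\<^sup>2"
    and R: "0 < R" "2 * r \<le> R" and K: "0 \<le> K"
  shows "norm (integral {-R..R} (\<lambda>w. h (Complex 0 w))) \<le> 16 * K / R"
proof -
  define a b c where "a = Complex 0 (-R)" and "b = Complex R 0" and "c = Complex 0 R"
  have hull: "convex hull {a, b, c} \<subseteq> {s. 0 \<le> Re s}"
    by (rule hull_minimal) (use R in \<open>auto simp: a_def b_def c_def convex_halfspace_Re_ge\<close>)
  have hol: "h holomorphic_on convex hull {a, b, c}"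
    using holo hull holomorphic_on_subset by blast
  have cont: "continuous_on (convex hull {a, b, c}) h"
    using hol by (rule holomorphic_on_imp_continuous_on)
  have seg: "closed_segment x y \<subseteq> convex hull {a, b, c}" if "x \<in> {a,b,c}" "y \<in> {a,b,c}" for x y
    unfolding segment_convex_hull using that by (intro hull_mono) auto
  have int: "h contour_integrable_on linepath x y" if "x \<in> {a,b,c}" "y \<in> {a,b,c}" for x y
    using seg [OF that] cont contour_integrable_continuous_linepath continuous_on_subset by blast
  have "contour_integral (linepath a b +++ linepath b c +++ linepath c a) h = 0"
    using Cauchy_theorem_triangle [OF hol] by (rule contour_integral_unique)
  then have sum0: "contour_integral (linepath a b) h + contour_integral (linepath b c) h
      + contour_integral (linepath c a) h = 0"
    using int by (simp add: add.assoc)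
  have bound: "norm (contour_integral (linepath x y) h) \<le> 8 * K / R"
    if xy: "x \<in> {a,b,c}" "y \<in> {a,b,c}" and len: "norm (y - x) \<le> 2 * R"
      and far: "\<And>s. s \<in> closed_segment x y \<Longrightarrow> R \<le> 2 * norm s" for x y
  proof -
    have "norm (h s) \<le> 4 * K / R\<^sup>2" if s: "s \<in> closed_segment x y" for s
    proof -
      have "R \<le> 2 * norm s" using far s .
      then have "(R / 2)\<^sup>2 \<le> (norm s)\<^sup>2" and "r \<le> norm s"
        using R by (auto intro: power_mono)
      moreover have "0 \<le> Re s" using s seg [OF xy] hull by auto
      ultimately have "norm (h s) \<le> K / (norm s)\<^sup>2" using decay by blast
      also have "\<dots> \<le> K / (R / 2)\<^sup>2"
        using \<open>(R / 2)\<^sup>2 \<le> (norm s)\<^sup>2\<close> R(1) K by (intro divide_left_mono) (auto intro!: mult_pos_pos)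
      finally show ?thesis by (simp add: power_divide mult.commute)
    qed
    then have "norm (contour_integral (linepath x y) h) \<le> 4 * K / R\<^sup>2 * norm (y - x)"
      using int [OF xy] K by (intro contour_integral_bound_linepath) auto
    also have "\<dots> \<le> 4 * K / R\<^sup>2 * (2 * R)"
      using len K by (intro mult_left_mono) auto
    also have "\<dots> = 8 * K / R" using R(1) by (simp add: power2_eq_square)
    finally show ?thesis .
  qed
  have nab: "norm (b - a) \<le> 2 * R" "norm (c - b) \<le> 2 * R"
    using R norm_triangle_ineq4 [of b a] norm_triangle_ineq4 [of c b]
    by (auto simp: a_def b_def c_def cmod_def)
  \<comment> \<open>This side lies on the line \<open>Re s - Im s = R\<close>, so one coordinate has
    modulus at least \<open>R / 2\<close>; \<open>far_bc\<close> is its mirror image.\<close>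
  have far_ab: "R \<le> 2 * norm s" if s: "s \<in> closed_segment a b" for s
  proof -
    have "R = Re s - Im s"
      using s by (auto simp: closed_segment_def a_def b_def left_diff_distrib)
    then show ?thesis using abs_Re_le_cmod [of s] abs_Im_le_cmod [of s] by linarith
  qed
  have far_bc: "R \<le> 2 * norm s" if s: "s \<in> closed_segment b c" for s
  proof -
    have "R = Re s + Im s"
      using s by (auto simp: closed_segment_def b_def c_def left_diff_distrib)
    then show ?thesis using abs_Re_le_cmod [of s] abs_Im_le_cmod [of s] by linarith
  qed
  have "contour_integral (linepath a c) h = - contour_integral (linepath c a) h"
    using contour_integral_reversepath [of "linepath c a" h] by simp
  also have "\<dots> = contour_integral (linepath a b) h + contour_integral (linepath b c) h"
    using sum0 by (simp add: eq_neg_iff_add_eq_0 neg_eq_iff_add_eq_0 add.commute)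
  also have "norm \<dots> \<le> 8 * K / R + 8 * K / R"
    using bound [of a b] bound [of b c] nab far_ab far_bc by (intro norm_triangle_mono) auto
  finally have "norm (contour_integral (linepath a c) h) \<le> 16 * K / R" by simp
  moreover have "contour_integral (linepath a c) h = \<i> * integral {-R..R} (\<lambda>w. h (Complex 0 w))"
    using R by (intro contour_integral_linepath_same_Re) (auto simp: a_def c_def)
  ultimately show ?thesis by (simp add: norm_mult)
qed

lemma has_bochner_integral_inverse_1_plus_square:
  "has_bochner_integral lborel (\<lambda>w::real. inverse (1 + w\<^sup>2)) pi"
proof -
  have "einterval (-\<infinity>) \<infinity> = UNIV" by (auto simp: einterval_def)
  then show ?thesis
    using integrable_inverse_1_plus_square LBINT_inverse_1_plus_square
    by (simp add: has_bochner_integral_iff set_integrable_def interval_lebesgue_integral_def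
        set_lebesgue_integral_def)
qed

text \<open>Quadratic decay dominates the integrand by a multiple of
  \<open>inverse (1 + w\<^sup>2)\<close>, so the integral is the limit of its truncations to
  \<open>{-R..R}\<close>, and the triangle bound sends these to 0.\<close>

lemma has_bochner_integral_imaginary_axis_eq_0:
  assumes holo: "h holomorphic_on {s. 0 \<le> Re s}"
    and decay: "\<And>s. 0 \<le> Re s \<Longrightarrow> r \<le> norm s \<Longrightarrow> norm (h s) \<le> K / (norm s)\<^sup>2"
  shows "has_bochner_integral lborel (\<lambda>w. h (\<i> * complex_of_real w)) 0"
proof -
  define g where "g w = h (\<i> * complex_of_real w)" for w :: real
  \<comment> \<open>Beyond \<open>q\<close> the decay hypothesis applies, and
    \<open>1 \<le> w\<^sup>2\<close> turns \<open>K / w\<^sup>2\<close> into at most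
    \<open>2 * K / (1 + w\<^sup>2)\<close>.\<close>
  define q where "q = max r 1"
  have iw: "\<i> * complex_of_real w = Complex 0 w" for w by (simp add: complex_eq_iff)
  \<comment> \<open>The sign of \<open>K\<close> is implicit in the decay bound; one real point of
    the half plane reveals it.\<close>
  have K: "0 \<le> K"
  proof -
    have "0 \<le> norm (h (of_real q))" by simp
    also have "\<dots> \<le> K / (norm (complex_of_real q))\<^sup>2" by (rule decay) (auto simp: q_def)
    finally show ?thesis by (auto simp: q_def zero_le_divide_iff)
  qed
  have cont: "continuous_on UNIV g"
    unfolding g_def
    by (rule continuous_on_compose2 [OF holomorphic_on_imp_continuous_on [OF holo]])
       (auto intro!: continuous_intros)
  then have meas: "g \<in> borel_measurable lborel"
    by (simp add: borel_measurable_continuous_onI)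
  have "compact (g ` {-q..q})"
    using cont by (intro compact_continuous_image) (auto intro: continuous_on_subset)
  then obtain B where B: "\<And>w. w \<in> {-q..q} \<Longrightarrow> norm (g w) \<le> B" and "0 \<le> B"
    by (metis (no_types, lifting) bounded_pos compact_imp_bounded imageI less_eq_real_def)
  \<comment> \<open>The first summand covers the compact range up to \<open>q\<close>, the second
    the tail.\<close>
  define M where "M = B * (1 + q\<^sup>2) + 2 * K"
  have g_le: "norm (g w) \<le> M * inverse (1 + w\<^sup>2)" for w
  proof (cases "\<bar>w\<bar> \<le> q")
    case True
    then have "w\<^sup>2 \<le> q\<^sup>2" using abs_le_square_iff [of w q] by (simp add: q_def)
    have "norm (g w) * (1 + w\<^sup>2) \<le> B * (1 + q\<^sup>2)"
      using True \<open>w\<^sup>2 \<le> q\<^sup>2\<close> \<open>0 \<le> B\<close> by (intro mult_mono B) auto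
    also have "\<dots> \<le> M" using K by (simp add: M_def)
    finally show ?thesis by (simp add: field_simps add_pos_nonneg)
  next
    case False
    then have w: "1 \<le> \<bar>w\<bar>" "r \<le> \<bar>w\<bar>" by (auto simp: q_def)
    then have w2: "1 \<le> w\<^sup>2" using abs_le_square_iff [of 1 w] by simp
    have "norm (g w) \<le> K / w\<^sup>2"
      using decay [of "\<i> * complex_of_real w"] w by (simp add: g_def norm_mult)
    also have "\<dots> \<le> 2 * K / (1 + w\<^sup>2)"
    proof (rule mult_imp_le_div_pos)
      have "K / w\<^sup>2 * (1 + w\<^sup>2) = K / w\<^sup>2 + K" using w by (auto simp: distrib_left)
      also have "K / w\<^sup>2 \<le> K" using w2 K mult_left_mono [OF w2 K] by (simp add: divide_le_eq)
      finally show "K / w\<^sup>2 * (1 + w\<^sup>2) \<le> 2 * K" by simp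
    qed (simp add: add_pos_nonneg)
    also have "\<dots> \<le> M / (1 + w\<^sup>2)"
      using \<open>0 \<le> B\<close> by (intro divide_right_mono) (auto simp: M_def)
    finally show ?thesis by (simp add: divide_inverse)
  qed
  have intM: "integrable lborel (\<lambda>w::real. M * inverse (1 + w\<^sup>2))"
    using has_bochner_integral_inverse_1_plus_square by (auto simp: has_bochner_integral_iff)
  have int: "integrable lborel g"
    by (rule Bochner_Integration.integrable_bound [OF intM meas])
       (use g_le in \<open>auto intro!: order_trans [OF _ abs_ge_self]\<close>)
  have "((\<lambda>R. LINT w|lborel. indicator {-R..R} w *\<^sub>R g w) \<longlongrightarrow> integral\<^sup>L lborel g) at_top"
  proof (rule integral_dominated_convergence_at_top [OF meas _ intM])
    show "\<And>R. (\<lambda>w. indicator {-R..R} w *\<^sub>R g w) \<in> borel_measurable lborel"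
      using meas by measurable
    have "((\<lambda>R. indicator {-R..R} w *\<^sub>R g w) \<longlongrightarrow> g w) at_top" for w
    proof (rule tendsto_eventually)
      show "\<forall>\<^sub>F R in at_top. indicator {-R..R} w *\<^sub>R g w = g w"
        using eventually_ge_at_top [of "\<bar>w\<bar>"] by eventually_elim (auto simp: indicator_def)
    qed
    then show "AE w in lborel. ((\<lambda>R. indicator {-R..R} w *\<^sub>R g w) \<longlongrightarrow> g w) at_top" by simp
    have "norm (indicator {-R..R} w *\<^sub>R g w) \<le> M * inverse (1 + w\<^sup>2)" for R w
      using g_le [of w] order_trans [OF norm_ge_zero g_le [of w]] by (auto simp: indicator_def)
    then show "\<forall>\<^sub>F R in at_top. AE w in lborel.
        norm (indicator {-R..R} w *\<^sub>R g w) \<le> M * inverse (1 + w\<^sup>2)" by simp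
  qed
  moreover have "((\<lambda>R. LINT w|lborel. indicator {-R..R} w *\<^sub>R g w) \<longlongrightarrow> 0) at_top"
  proof (rule Lim_null_comparison)
    show "((\<lambda>R. 16 * K / R) \<longlongrightarrow> 0) at_top"
      by (intro tendsto_divide_0 [OF tendsto_const] filterlim_at_top_imp_at_infinity filterlim_ident)
    show "\<forall>\<^sub>F R in at_top. norm (LINT w|lborel. indicator {-R..R} w *\<^sub>R g w) \<le> 16 * K / R"
      using eventually_gt_at_top [of 0] eventually_ge_at_top [of "2 * r"]
    proof eventually_elim
      case (elim R)
      have "set_integrable lborel {-R..R} g"
        using cont by (intro borel_integrable_atLeastAtMost') (auto intro: continuous_on_subset)
      then have "(LINT w|lborel. indicator {-R..R} w *\<^sub>R g w) = integral {-R..R} g"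
        using set_borel_integral_eq_integral(2) by (simp add: set_lebesgue_integral_def)
      then show ?case
        using half_plane_contour_integral_bound [OF holo decay elim K]
        by (simp add: g_def [abs_def] iw)
    qed
  qed
  ultimately have "integral\<^sup>L lborel g = 0"
    by (rule tendsto_unique [OF trivial_limit_at_top_linorder])
  with int show ?thesis by (simp add: has_bochner_integral_iff g_def [abs_def])
qed

lemma LINT_imaginary_axis:
  fixes F :: "complex \<Rightarrow> complex" and c :: complex
  assumes holo: "F holomorphic_on {s. 0 \<le> Re s}"
    and decay: "\<And>s. 0 \<le> Re s \<Longrightarrow> r \<le> norm s \<Longrightarrow> norm (F s - c / s) \<le> K / (norm s)\<^sup>2"
  shows "(LINT w|lborel. F (\<i> * complex_of_real w) + F (- (\<i> * complex_of_real w)))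
           = 2 * pi * c"
proof -
  \<comment> \<open>The pole of the subtracted term is at \<open>-1\<close>, so \<open>h\<close> stays holomorphic on the half plane.\<close>
  define h where "h s = F s - c / (s + 1)" for s :: complex
  have ne: "s + 1 \<noteq> 0" if "0 \<le> Re s" for s
    using that by (auto simp: complex_eq_iff)
  have "has_bochner_integral lborel (\<lambda>w. h (\<i> * complex_of_real w)) 0"
  proof (rule has_bochner_integral_imaginary_axis_eq_0)
    show "h holomorphic_on {s. 0 \<le> Re s}"
      unfolding h_def using ne by (auto intro!: holomorphic_intros holo)
    \<comment> \<open>The radius 1 keeps \<open>s\<close> away from 0, where \<open>c / s\<close>
      would take its default value.\<close>
    fix s assume s: "0 \<le> Re s" "max r 1 \<le> norm s"
    then have s0: "s \<noteq> 0" by auto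
    have "norm s \<le> norm (s + 1)"
      using s by (simp add: cmod_def power2_eq_square algebra_simps)
    then have "norm c / (norm s * norm (s + 1)) \<le> norm c / (norm s * norm s)"
      using s0 ne [OF s(1)] by (intro divide_left_mono mult_left_mono mult_pos_pos) auto
    moreover have "c / s - c / (s + 1) = c / (s * (s + 1))"
      using s0 ne [OF s(1)] by (simp add: field_simps)
    ultimately have "norm (c / s - c / (s + 1)) \<le> norm c / (norm s)\<^sup>2"
      by (simp only: norm_divide norm_mult power2_eq_square)
    moreover have "norm (F s - c / s) \<le> K / (norm s)\<^sup>2" using decay s by simp
    ultimately have "norm ((F s - c / s) + (c / s - c / (s + 1))) \<le> K / (norm s)\<^sup>2 + norm c / (norm s)\<^sup>2"
      by (intro norm_triangle_mono)
    then show "norm (h s) \<le> (K + norm c) / (norm s)\<^sup>2"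
      by (simp add: h_def add_divide_distrib)
  qed
  note h1 = this
  \<comment> \<open>Reflection \<open>w \<mapsto> -w\<close>, as an affine substitution with factor
    \<open>-1\<close>.\<close>
  have h2: "has_bochner_integral lborel (\<lambda>w. h (- (\<i> * complex_of_real w))) 0"
    using lborel_has_bochner_integral_real_affine_iff [of "-1" "\<lambda>w. h (\<i> * complex_of_real w)" 0 0] h1
    by simp
  have h3: "has_bochner_integral lborel (\<lambda>w. 2 * c * complex_of_real (inverse (1 + w\<^sup>2))) (2 * c * pi)"
    using has_bochner_integral_inverse_1_plus_square
    by (intro has_bochner_integral_mult_right has_bochner_integral_of_real) auto
  have eq: "F (\<i> * complex_of_real w) + F (- (\<i> * complex_of_real w))
     = h (\<i> * complex_of_real w) + h (- (\<i> * complex_of_real w))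
       + 2 * c * complex_of_real (inverse (1 + w\<^sup>2))" for w
  proof -
    have "1 / (\<i> * complex_of_real w + 1) + 1 / (- (\<i> * complex_of_real w) + 1)
        = 2 * complex_of_real (inverse (1 + w\<^sup>2))"
    proof -
      have "(\<i> * complex_of_real w + 1) * (- (\<i> * complex_of_real w) + 1) = complex_of_real (1 + w\<^sup>2)"
        by (simp add: algebra_simps power2_eq_square)
      moreover have ne: "\<i> * complex_of_real w + 1 \<noteq> 0" "- (\<i> * complex_of_real w) + 1 \<noteq> 0"
        by (auto simp: complex_eq_iff)
      ultimately have "1 / (\<i> * complex_of_real w + 1) + 1 / (- (\<i> * complex_of_real w) + 1)
          = 2 / complex_of_real (1 + w\<^sup>2)"
        by (subst add_frac_eq [OF ne]) simp
      then show ?thesis by (simp add: divide_inverse)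
    qed
    then have "c * (1 / (\<i> * complex_of_real w + 1) + 1 / (- (\<i> * complex_of_real w) + 1))
        = c * (2 * complex_of_real (inverse (1 + w\<^sup>2)))" by simp
    then show ?thesis by (simp add: h_def algebra_simps)
  qed
  show ?thesis
    unfolding eq
    using has_bochner_integral_integral_eq
      [OF has_bochner_integral_add [OF has_bochner_integral_add [OF h1 h2] h3]]
    by (simp add: mult_ac)
qed

section \<open>Resolvents and the Lyapunov equation\<close>

lemma matrix_inv_inverse:
  fixes M :: "'a::semiring_1^'n^'n"
  assumes "invertible M"
  shows "M ** matrix_inv M = mat 1" and "matrix_inv M ** M = mat 1"
  using someI_ex [OF assms [unfolded invertible_def]] by (simp_all add: matrix_inv_def)

lemma matrix_add_rdistrib: "(M + N) ** P = M ** P + N ** P" for M :: "'a::semiring_1^'n^'m"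
  by (simp add: vec_eq_iff matrix_matrix_mult_def distrib_right sum.distrib)

lemma matrix_diff_ldistrib: "M ** (N - P) = M ** N - M ** P" for M :: "'a::ring_1^'n^'m"
  by (simp add: vec_eq_iff matrix_matrix_mult_def right_diff_distrib sum_subtractf)

lemma matrix_diff_rdistrib: "(M - N) ** P = M ** P - N ** P" for M :: "'a::ring_1^'n^'m"
  by (simp add: vec_eq_iff matrix_matrix_mult_def left_diff_distrib sum_subtractf)

section \<open>Holomorphy and decay of the resolvent\<close>

lemma holomorphic_on_det:
  fixes M :: "complex \<Rightarrow> complex^'n^'n"
  assumes "\<And>i j. (\<lambda>s. M s $ i $ j) holomorphic_on U"
  shows "(\<lambda>s. det (M s)) holomorphic_on U"
  unfolding det_def by (intro holomorphic_intros assms)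

text \<open>By Cramer's rule each entry is a quotient of determinants that are holomorphic in
  \<open>s\<close>, with a denominator that does not vanish on \<open>U\<close>.\<close>

lemma holomorphic_on_resolvent:
  fixes Z :: "complex^'n^'n"
  assumes inv: "\<And>s. s \<in> U \<Longrightarrow> invertible (mat s - Z)"
  shows "(\<lambda>s. matrix_inv (mat s - Z) $ i $ j) holomorphic_on U"
proof -
  \<comment> \<open>Cramer's numerator: column \<open>i\<close> of \<open>mat s - Z\<close> is
    replaced by the unit vector \<open>axis j 1\<close>.\<close>
  define N :: "complex \<Rightarrow> complex^'n^'n" where
    "N s = (\<chi> k l. if l = i then axis j 1 $ k else (mat s - Z) $ k $ l)" for s
  have entry: "(\<lambda>s. (mat s - Z) $ k $ l) holomorphic_on U" for k l
    by (cases "k = l") (auto simp: mat_def intro!: holomorphic_intros)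
  have N: "(\<lambda>s. N s $ k $ l) holomorphic_on U" for k l
    unfolding N_def using entry by (cases "l = i") (auto intro!: holomorphic_intros)
  have "(\<lambda>s. det (N s) / det (mat s - Z)) holomorphic_on U"
    using inv by (intro holomorphic_intros holomorphic_on_det N entry) (simp add: invertible_det_nz)
  moreover have "det (N s) / det (mat s - Z) = matrix_inv (mat s - Z) $ i $ j" if "s \<in> U" for s
  proof -
    have "(mat s - Z) *v (matrix_inv (mat s - Z) *v axis j 1) = axis j 1"
      by (simp add: matrix_vector_mul_assoc matrix_inv_inverse inv that)
    then have "matrix_inv (mat s - Z) *v axis j 1
        = (\<chi> k. det (\<chi> i' j'. if j' = k then axis j 1 $ i' else (mat s - Z) $ i' $ j') / det (mat s - Z))"
      using inv [OF that] by (subst (asm) cramer) (auto simp: invertible_det_nz)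
    then have "(matrix_inv (mat s - Z) *v axis j 1) $ i = det (N s) / det (mat s - Z)"
      by (simp add: N_def)
    then show ?thesis
      by (simp add: matrix_vector_mult_def axis_def if_distrib [of "\<lambda>x. _ * x"] cong: if_cong)
  qed
  ultimately show ?thesis by (rule holomorphic_transform)
qed

lemma norm_mat_mult:
  fixes M :: "complex^'n^'m"
  shows "norm (mat s ** M) = norm s * norm M"
proof -
  have "mat s ** M = (\<chi> i j. s * M $ i $ j)"
    by (simp add: vec_eq_iff matrix_matrix_mult_def mat_def if_distrib [of "\<lambda>x. x * _"] cong: if_cong)
  then show ?thesis
    by (simp add: norm_vec_def norm_mult L2_set_right_distrib)
qed

lemma mat_mult_mat: "mat s ** mat t = (mat (s * t) :: 'a::semiring_1^'n^'n)"
  by (simp add: vec_eq_iff matrix_matrix_mult_def mat_def if_distrib [of "\<lambda>x. x * _"] cong: if_cong)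

text \<open>The identity \<open>s R = I + Z R\<close> is used twice: it first gives
  \<open>R = O(1 / s)\<close>, and then \<open>R - I / s = Z R / s\<close> gains another factor
  \<open>1 / s\<close>.\<close>

lemma resolvent_decay:
  fixes Z :: "complex^'n^'n"
  obtains K r where
    "\<And>s. invertible (mat s - Z) \<Longrightarrow> r \<le> norm s \<Longrightarrow>
       norm (matrix_inv (mat s - Z) - mat (1 / s)) \<le> K / (norm s)\<^sup>2"
proof -
  have "linear (\<lambda>M :: complex^'n^'n. Z ** M)"
    by (rule linearI) (simp_all add: vec_eq_iff matrix_matrix_mult_def scaleR_sum_right distrib_left sum.distrib)
  then obtain k where k: "0 < k" "\<And>M :: complex^'n^'n. norm (Z ** M) \<le> k * norm M"
    using linear_bounded_pos by blast
  \<comment> \<open>For \<open>2 * k \<le> norm s\<close> the term \<open>k * norm R\<close> is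
    absorbed into half of \<open>norm s * norm R\<close>, whence the factor 2. The matrix norm is
    Euclidean, so \<open>norm (mat 1)\<close> is not 1 in general.\<close>
  define K where "K = 2 * k * norm (mat 1 :: complex^'n^'n)"
  show ?thesis
  proof (rule that)
    fix s assume inv: "invertible (mat s - Z)" and s: "2 * k \<le> norm s"
    define R where "R = matrix_inv (mat s - Z)"
    have pos: "0 < norm s" using s k(1) by linarith
    then have s0: "s \<noteq> 0" by auto
    have "mat s ** R - Z ** R = mat 1"
      using matrix_inv_inverse(1) [OF inv] by (simp add: R_def matrix_diff_rdistrib)
    then have sR: "mat s ** R = mat 1 + Z ** R" by (simp add: algebra_simps)
    have "norm s * norm R = norm (mat 1 + Z ** R)" by (simp add: norm_mat_mult flip: sR)
    also have "\<dots> \<le> norm (mat 1 :: complex^'n^'n) + k * norm R"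
      using k(2) by (rule norm_triangle_mono [OF order_refl])
    also have "k * norm R \<le> norm s / 2 * norm R"
      using s by (intro mult_right_mono) auto
    finally have R_le: "norm s * norm R \<le> 2 * norm (mat 1 :: complex^'n^'n)" by simp
    have "mat s ** (R - mat (1 / s)) = Z ** R"
      using s0 by (simp add: matrix_diff_ldistrib sR mat_mult_mat)
    then have "norm s * norm (R - mat (1 / s)) = norm (Z ** R)"
      by (metis norm_mat_mult)
    then have "(norm s)\<^sup>2 * norm (R - mat (1 / s)) = norm s * norm (Z ** R)"
      by (simp add: power2_eq_square)
    also have "\<dots> \<le> norm s * (k * norm R)"
      using k(2) by (intro mult_left_mono) auto
    also have "\<dots> \<le> K"
      using mult_left_mono [OF R_le, of k] k(1) by (simp add: K_def mult_ac)
    finally show "norm (matrix_inv (mat s - Z) - mat (1 / s)) \<le> K / (norm s)\<^sup>2"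
      using pos by (simp add: R_def field_simps)
  qed
qed

text \<open>Since the resolvent is \<open>I / s + O(1 / s\<^sup>2)\<close>, the coefficient
  \<open>c\<close> of the scalar lemma is \<open>trace M\<close>.\<close>

lemma LINT_trace_resolvent:
  fixes M Z :: "complex^'n^'n"
  assumes inv: "\<And>s. 0 \<le> Re s \<Longrightarrow> invertible (mat s - Z)"
  shows "(LINT w|lborel. trace (M ** matrix_inv (mat (\<i> * complex_of_real w) - Z))
            + trace (M ** matrix_inv (mat (- (\<i> * complex_of_real w)) - Z)))
         = 2 * pi * trace M"
proof -
  have "linear (\<lambda>N :: complex^'n^'n. trace (M ** N))"
    by (rule linearI)
       (simp_all add: trace_def matrix_matrix_mult_def scaleR_sum_right distrib_left sum.distrib)
  then obtain k where k: "0 < k" "\<And>N :: complex^'n^'n. norm (trace (M ** N)) \<le> k * norm N"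
    using linear_bounded_pos by blast
  obtain K r where K: "\<And>s. invertible (mat s - Z) \<Longrightarrow> r \<le> norm s \<Longrightarrow>
       norm (matrix_inv (mat s - Z) - mat (1 / s)) \<le> K / (norm s)\<^sup>2"
    using resolvent_decay [of Z] by blast
  show ?thesis
  proof (rule LINT_imaginary_axis)
    show "(\<lambda>s. trace (M ** matrix_inv (mat s - Z))) holomorphic_on {s. 0 \<le> Re s}"
      unfolding trace_def matrix_matrix_mult_def
      using inv by (auto intro!: holomorphic_intros holomorphic_on_resolvent)
    fix s assume s: "0 \<le> Re s" "r \<le> norm s"
    have "trace (M ** mat (1 / s)) = trace M / s"
      by (simp add: trace_def matrix_matrix_mult_def mat_def sum_divide_distrib
          if_distrib [of "\<lambda>x. _ * x"] cong: if_cong)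
    then have "trace (M ** matrix_inv (mat s - Z)) - trace M / s
        = trace (M ** (matrix_inv (mat s - Z) - mat (1 / s)))"
      by (simp add: matrix_diff_ldistrib trace_sub)
    also have "norm \<dots> \<le> k * norm (matrix_inv (mat s - Z) - mat (1 / s))" by (rule k(2))
    also have "\<dots> \<le> k * (K / (norm s)\<^sup>2)"
      using k(1) K [OF inv [OF s(1)] s(2)] by (intro mult_left_mono) auto
    finally show "norm (trace (M ** matrix_inv (mat s - Z)) - trace M / s) \<le> k * K / (norm s)\<^sup>2"
      by simp
  qed
qed

section \<open>From real to complex matrices\<close>

lemma complex_matrix_mult: "complex_matrix (M ** N) = complex_matrix M ** complex_matrix N"
  by (simp add: complex_matrix_def map_matrix_def vec_eq_iff matrix_matrix_mult_def)

lemma complex_matrix_transpose: "complex_matrix (transpose M) = transpose (complex_matrix M)"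
  by (simp add: complex_matrix_def map_matrix_def vec_eq_iff transpose_def)

lemma complex_matrix_add: "complex_matrix (M + N) = complex_matrix M + complex_matrix N"
  by (simp add: complex_matrix_def map_matrix_def vec_eq_iff)

lemma complex_matrix_0: "complex_matrix 0 = 0"
  by (simp add: complex_matrix_def map_matrix_def vec_eq_iff)

lemma trace_complex_matrix: "trace (complex_matrix M) = complex_of_real (trace M)"
  by (simp add: complex_matrix_def map_matrix_def trace_def)

lemma trace_transpose: "trace (transpose M) = trace M"
  by (simp add: trace_def transpose_def)

text \<open>A nonzero kernel vector would be an eigenvector of \<open>A\<close> for the eigenvalue
  \<open>s\<close>, outside the open left half plane.\<close>

lemma hurwitz_imp_invertible:
  assumes "hurwitz A" "0 \<le> Re s"
  shows "invertible (mat s - complex_matrix A)"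
proof -
  have "v = 0" if "(mat s - complex_matrix A) *v v = 0" for v
  proof (rule ccontr)
    assume "v \<noteq> 0"
    have "mat s *v v = s *s v"
      by (simp add: vec_eq_iff matrix_vector_mult_def mat_def if_distrib [of "\<lambda>x. x * _"] cong: if_cong)
    then have "complex_matrix A *v v = s *s v"
      using that by (simp add: matrix_vector_mult_diff_rdistrib)
    then show False using assms \<open>v \<noteq> 0\<close> by (auto simp: hurwitz_def)
  qed
  then show ?thesis
    by (simp add: invertible_left_inverse matrix_left_invertible_ker)
qed

text \<open>The bridge from the frequency integral to the Lyapunov form. With a plain transpose and
  the argument \<open>- s\<close>, the integrand is an algebraic expression in \<open>R s\<close>
  and \<open>R (- s)\<close>, and no conjugation has to be handled.\<close>

theorem h2_norm_squared_eq_trace: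
  fixes A X :: "real^'n^'n" and B :: "real^'m^'n" and C :: "real^'n^'p"
  assumes "hurwitz A" and sym: "transpose X = X"
    and lyapunov: "transpose A ** X + X ** A + transpose C ** C = 0"
  shows "h2_norm_squared A B C = complex_of_real (trace (transpose B ** X ** B))"
proof -
  define Ac Bc Cc Xc where "Ac = complex_matrix A" and "Bc = complex_matrix B"
    and "Cc = complex_matrix C" and "Xc = complex_matrix X"
  define M where "M = Bc ** transpose Bc ** Xc"
  define R where "R s = matrix_inv (mat s - Ac)" for s
  note inv = hurwitz_imp_invertible [OF assms(1), folded Ac_def]
  have Xsym: "transpose Xc = Xc"
    by (simp add: Xc_def sym flip: complex_matrix_transpose)
  have "transpose Ac ** Xc + Xc ** Ac + transpose Cc ** Cc = 0"
    using arg_cong [OF lyapunov, of complex_matrix]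
    by (simp add: Ac_def Xc_def Cc_def complex_matrix_mult complex_matrix_transpose
        complex_matrix_add complex_matrix_0)
  then have CC: "transpose Cc ** Cc = - (transpose Ac ** Xc) - Xc ** Ac"
    by (simp add: algebra_simps eq_neg_iff_add_eq_0)
  \<comment> \<open>The two resolvents in the transfer functions cancel one factor each.\<close>
  have split: "transpose Cc ** Cc = transpose (mat (- s) - Ac) ** Xc + Xc ** (mat s - Ac)" for s
  proof -
    have tr: "transpose (mat (- s) - Ac) = mat (- s) - transpose Ac"
      by (simp add: vec_eq_iff transpose_def mat_def)
    have scal: "mat (- s) ** Xc = - (Xc ** mat s)"
      by (simp add: vec_eq_iff matrix_matrix_mult_def mat_def if_distrib [of "\<lambda>x. x * _"]
          if_distrib [of "\<lambda>x. _ * x"] cong: if_cong)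
    show ?thesis
      unfolding CC tr matrix_diff_ldistrib matrix_diff_rdistrib scal by simp
  qed
  have cyclic: "trace (transpose Bc ** Xc ** N ** Bc) = trace (M ** N)" for N
    by (subst trace_mul_sym) (simp add: M_def matrix_mul_assoc)
  have trace_eq: "trace (transpose (Cc ** R (- s) ** Bc) ** (Cc ** R s ** Bc))
      = trace (M ** R s) + trace (M ** R (- s))" if s: "Re s = 0" for s
  proof -
    have "transpose (R (- s)) ** transpose (mat (- s) - Ac) = mat 1"
      using matrix_inv_inverse(1) [OF inv, of "- s"] s
      by (simp add: R_def flip: matrix_transpose_mul)
    moreover have "(mat s - Ac) ** R s = mat 1"
      using matrix_inv_inverse(1) [OF inv, of s] s by (simp add: R_def)
    ultimately have RCCR: "transpose (R (- s)) ** (transpose Cc ** Cc) ** R s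
        = Xc ** R s + transpose (R (- s)) ** Xc"
      by (simp add: split [of s] matrix_add_ldistrib matrix_add_rdistrib matrix_mul_assoc
          flip: matrix_mul_assoc [of _ "mat s - Ac" "R s"])
    have "transpose (Cc ** R (- s) ** Bc) ** (Cc ** R s ** Bc)
        = transpose Bc ** (transpose (R (- s)) ** (transpose Cc ** Cc) ** R s) ** Bc"
      by (simp add: matrix_transpose_mul matrix_mul_assoc)
    then have "trace (transpose (Cc ** R (- s) ** Bc) ** (Cc ** R s ** Bc))
        = trace (transpose Bc ** (Xc ** R s + transpose (R (- s)) ** Xc) ** Bc)"
      by (simp only: RCCR)
    also have "\<dots> = trace (transpose Bc ** Xc ** R s ** Bc)
        + trace (transpose Bc ** transpose (R (- s)) ** Xc ** Bc)"
      by (simp add: matrix_add_ldistrib matrix_add_rdistrib matrix_mul_assoc trace_add)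
    \<comment> \<open>Transposing inside the trace moves \<open>R (- s)\<close> to the right of the
      symmetric \<open>Xc\<close>, so that \<open>cyclic\<close> fits both terms.\<close>
    also have "trace (transpose Bc ** transpose (R (- s)) ** Xc ** Bc)
        = trace (transpose Bc ** Xc ** R (- s) ** Bc)"
      by (subst trace_transpose [symmetric]) (simp add: matrix_transpose_mul Xsym matrix_mul_assoc)
    finally show ?thesis by (simp add: cyclic)
  qed
  have "(LINT w|lborel. trace (transpose (transfer_function A B C (- (\<i> * complex_of_real w)))
                 ** transfer_function A B C (\<i> * complex_of_real w)))
      = (LINT w|lborel. trace (M ** R (\<i> * complex_of_real w)) + trace (M ** R (- (\<i> * complex_of_real w))))"
    by (simp add: transfer_function_def trace_eq flip: Ac_def Bc_def Cc_def R_def)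
  also have "\<dots> = 2 * pi * trace M"
    unfolding R_def using inv by (rule LINT_trace_resolvent)
  also have "trace M = trace (transpose Bc ** Xc ** Bc)"
    unfolding M_def by (metis matrix_mul_assoc trace_mul_sym)
  also have "\<dots> = complex_of_real (trace (transpose B ** X ** B))"
    by (simp add: Bc_def Xc_def complex_matrix_mult complex_matrix_transpose flip: trace_complex_matrix)
  finally show ?thesis by (simp add: h2_norm_squared_def)
qed

section \<open>The saddle-point system\<close>

lemma block_matrix_mult:
  fixes M11 :: "'a::semiring_1^'p::finite^'m" and M12 :: "'a^'q::finite^'m"
  shows "block_matrix M11 M12 M21 M22 ** block_matrix N11 N12 N21 N22
   = block_matrix (M11 ** N11 + M12 ** N21) (M11 ** N12 + M12 ** N22)
                  (M21 ** N11 + M22 ** N21) (M21 ** N12 + M22 ** N22)"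
  by (auto simp: vec_eq_iff matrix_matrix_mult_def block_matrix_def UNIV_sum_split split: sum.split)

lemma block_matrix_add:
  "block_matrix M11 M12 M21 M22 + block_matrix N11 N12 N21 N22
   = block_matrix (M11 + N11) (M12 + N12) (M21 + N21) (M22 + N22)"
  by (auto simp: vec_eq_iff block_matrix_def split: sum.split)

lemma block_matrix_0: "block_matrix 0 0 0 0 = 0"
  by (auto simp: vec_eq_iff block_matrix_def split: sum.split)

lemma transpose_block_matrix:
  "transpose (block_matrix M11 M12 M21 M22)
   = block_matrix (transpose M11) (transpose M21) (transpose M12) (transpose M22)"
  by (auto simp: vec_eq_iff transpose_def block_matrix_def split: sum.split)

lemma trace_block_matrix: "trace (block_matrix M11 M12 M21 M22) = trace M11 + trace M22"
  by (simp add: trace_def block_matrix_def UNIV_sum_split)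

lemma transpose_block_row_mult:
  "transpose (block_row M1 M2) ** block_row N1 N2
   = block_matrix (transpose M1 ** N1) (transpose M1 ** N2) (transpose M2 ** N1) (transpose M2 ** N2)"
  by (auto simp: vec_eq_iff matrix_matrix_mult_def block_matrix_def block_row_def transpose_def
      split: sum.split)

lemma block_vector_cases:
  obtains u v where "w = block_vector u v"
proof
  show "w = block_vector (\<chi> k. w $ Inl k) (\<chi> k. w $ Inr k)"
    by (simp add: vec_eq_iff block_vector_def split: sum.split)
qed

lemma block_vector_0: "block_vector 0 0 = 0"
  by (simp add: vec_eq_iff block_vector_def split: sum.split)

lemma inner_block_vector:
  "block_vector u v \<bullet> block_vector u' v' = u \<bullet> u' + v \<bullet> v'"
  by (simp add: inner_vec_def block_vector_def UNIV_sum_split)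

lemma transpose_0: "transpose 0 = 0"
  by (simp add: vec_eq_iff transpose_def)

lemma transpose_minus: "transpose (- M :: 'a::ring^'n^'m) = - transpose M"
  by (simp add: vec_eq_iff transpose_def)

lemma trace_scaleR: "trace (c *\<^sub>R M :: real^'n^'n) = c * trace M"
  by (simp add: trace_def sum_distrib_left)

lemma matrix_mult_minus_left: "(- M) ** N = - (M ** N)" for M :: "'a::ring_1^'n^'m"
  by (simp add: vec_eq_iff matrix_matrix_mult_def sum_negf)

lemma matrix_mult_minus_right: "M ** (- N) = - (M ** N)" for M :: "'a::ring_1^'n^'m"
  by (simp add: vec_eq_iff matrix_matrix_mult_def sum_negf)

section \<open>Positive definiteness and stability\<close>

lemma pos_def_mult_vector_eq_0:
  assumes "pos_def M" "M *v v = 0"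
  shows "v = 0"
  using assms by (metis inner_zero_right less_irrefl pos_def_def)

lemma pos_def_imp_invertible:
  assumes "pos_def M"
  shows "invertible M"
  using pos_def_mult_vector_eq_0 [OF assms]
  by (simp add: invertible_left_inverse matrix_left_invertible_ker)

lemma transpose_matrix_inv:
  fixes M :: "real^'n^'n"
  assumes "invertible M" "transpose M = M"
  shows "transpose (matrix_inv M) = matrix_inv M"
proof -
  have "transpose (matrix_inv M) ** M = mat 1"
    using matrix_inv_inverse(1) [OF assms(1)] assms(2) by (metis matrix_transpose_mul transpose_mat)
  then show ?thesis
    using matrix_inv_inverse(1) [OF assms(1)] by (metis matrix_mul_assoc matrix_mul_lid matrix_mul_rid)
qed

text \<open>The energy \<open>x \<bullet> (X *v x)\<close> dissipates at rate
  \<open>(norm (C *v x))\<^sup>2\<close>. If \<open>Re l\<close> were nonnegative, the real and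
  imaginary parts of the eigenvector would have zero output. Their span is invariant under
  \<open>A\<close>, so \<open>C *v (A *v x)\<close> vanishes there too, and
  \<open>observable\<close> makes both parts zero.\<close>

lemma hurwitz_if_lyapunov:
  fixes A X :: "real^'n^'n" and C :: "real^'n^'p"
  assumes X: "pos_def X"
    and lyapunov: "transpose A ** X + X ** A + transpose C ** C = 0"
    and observable: "\<And>v. C *v v = 0 \<Longrightarrow> C *v (A *v v) = 0 \<Longrightarrow> v = 0"
  shows "hurwitz A"
  unfolding hurwitz_def
proof (intro allI impI, elim conjE)
  fix l :: complex and v :: "complex^'n"
  assume v: "v \<noteq> 0" and eig: "complex_matrix A *v v = l *s v"
  \<comment> \<open>Real and imaginary parts keep the quadratic forms real.\<close>
  define a b where "a = (\<chi> i. Re (v $ i))" and "b = (\<chi> i. Im (v $ i))"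
  have eig_i: "(\<Sum>j\<in>UNIV. complex_of_real (A $ i $ j) * v $ j) = l * v $ i" for i
    using arg_cong [OF eig, of "\<lambda>w. w $ i"]
    by (simp add: matrix_vector_mult_def complex_matrix_def map_matrix_def)
  have Aa: "A *v a = Re l *\<^sub>R a - Im l *\<^sub>R b"
    using arg_cong [OF eig_i, of Re] by (simp add: vec_eq_iff matrix_vector_mult_def a_def b_def)
  have Ab: "A *v b = Im l *\<^sub>R a + Re l *\<^sub>R b"
    using arg_cong [OF eig_i, of Im]
    by (simp add: vec_eq_iff matrix_vector_mult_def a_def b_def algebra_simps)
  have sym: "x \<bullet> (X *v y) = y \<bullet> (X *v x)" for x y
    using X by (metis dot_lmul_matrix inner_commute pos_def_def transpose_matrix_vector)
  have energy: "2 * (x \<bullet> (X *v (A *v x))) = - ((norm (C *v x))\<^sup>2)" for x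
  proof -
    have tr: "x \<bullet> (y v* N) = (N *v x) \<bullet> y" for N :: "real^'n^'q::finite" and y
      by (metis dot_lmul_matrix inner_commute)
    have "0 = x \<bullet> ((transpose A ** X + X ** A + transpose C ** C) *v x)"
      by (simp add: lyapunov)
    also have "\<dots> = (A *v x) \<bullet> (X *v x) + x \<bullet> (X *v (A *v x)) + (C *v x) \<bullet> (C *v x)"
      by (simp add: matrix_vector_mult_add_rdistrib inner_add_right tr flip: matrix_vector_mul_assoc)
    finally show ?thesis using sym [of "A *v x" x] by (simp add: power2_norm_eq_inner)
  qed
  \<comment> \<open>The cross terms with \<open>Im l\<close> cancel by the symmetry of
    \<open>X\<close>.\<close>
  have "a \<bullet> (X *v (A *v a)) + b \<bullet> (X *v (A *v b)) = Re l * (a \<bullet> (X *v a) + b \<bullet> (X *v b))"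
    using sym [of b a]
    by (simp add: Aa Ab matrix_vector_mult_diff_distrib matrix_vector_right_distrib
        matrix_vector_mult_scaleR inner_diff_right inner_add_right algebra_simps)
  with energy [of a] energy [of b]
  have balance: "2 * Re l * (a \<bullet> (X *v a) + b \<bullet> (X *v b)) = - ((norm (C *v a))\<^sup>2 + (norm (C *v b))\<^sup>2)"
    by simp
  have nonneg: "0 \<le> x \<bullet> (X *v x)" for x
    using X by (cases "x = 0") (auto simp: pos_def_def less_imp_le)
  show "Re l < 0"
  proof (rule ccontr)
    assume "\<not> Re l < 0"
    then have "0 \<le> 2 * Re l * (a \<bullet> (X *v a) + b \<bullet> (X *v b))" using nonneg by simp
    then have "(norm (C *v a))\<^sup>2 + (norm (C *v b))\<^sup>2 = 0"
      unfolding balance by (intro antisym) simp_all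
    then have Ca: "C *v a = 0" and Cb: "C *v b = 0" by auto
    then have "C *v (A *v a) = 0" "C *v (A *v b) = 0"
      by (simp_all add: Aa Ab matrix_vector_mult_diff_distrib matrix_vector_right_distrib
          matrix_vector_mult_scaleR)
    then have "a = 0" "b = 0" using Ca Cb observable by auto
    then have "v = 0" by (auto simp: vec_eq_iff a_def b_def complex_eq_iff)
    with v show False ..
  qed
qed

text \<open>Row rank is invariant under transposition, and full column rank of
  \<open>transpose S\<close> is injectivity.\<close>

lemma full_row_rank_transpose_eq_0:
  assumes "full_row_rank S" "transpose S *v w = 0"
  shows "w = 0"
proof -
  have "inj ((*v) (transpose S))"
    using assms(1) by (simp add: full_row_rank_def rank_transpose flip: full_rank_injective)
  then show ?thesis using assms(2) by (metis injD matrix_vector_mult_0_right)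
qed

text \<open>Stability is part of the conclusion because \<open>h2_norm_squared\<close> carries its
  intended meaning only for a Hurwitz state matrix.\<close>

theorem mainTheorem1:
  fixes Q Tx :: "real^'x^'x"
    and S :: "real^'x^'r"
    and Tnu :: "real^'r^'r"
    and Wb :: "real^'b^'r"
    and tb tc :: real
  assumes "CARD('r) < CARD('x)"
    and "diagonal_matrix Q" and "pos_def Q"
    and "full_row_rank S" and "full_row_rank Wb"
    and "diagonal_matrix Tx" and "pos_def Tx"
    and "diagonal_matrix Tnu" and "pos_def Tnu"
    and "tb \<ge> 0" and "tc \<ge> 0"
  shows "hurwitz (saddle_A Q S Tx Tnu) \<and>
         h2_norm_squared (saddle_A Q S Tx Tnu) (saddle_B Wb Tx Tnu tc tb)
             (saddle_C Q :: real^('x + 'r)^'x)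
           = complex_of_real
               (tc\<^sup>2 / 2 * trace (matrix_inv Tx)
                + tb\<^sup>2 / 2 * trace (transpose Wb ** matrix_inv Tnu ** Wb))"
proof
  define A where "A = saddle_A Q S Tx Tnu"
  define B where "B = saddle_B Wb Tx Tnu tc tb"
  define C where "C = (saddle_C Q :: real^('x + 'r)^'x)"
  \<comment> \<open>The weights \<open>Tx\<close> and \<open>Tnu\<close> cancel the inverses in
    \<open>saddle_A\<close>; the factor 1/2 makes the two copies of \<open>- Q / 2\<close> add up to
    \<open>- Q\<close>.\<close>
  define X where "X = block_matrix ((1/2) *\<^sub>R Tx) 0 0 ((1/2) *\<^sub>R Tnu)"
  have symQ: "transpose Q = Q" and symTx: "transpose Tx = Tx" and symTnu: "transpose Tnu = Tnu"
    using assms by (simp_all add: pos_def_def)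
  have invTx: "invertible Tx" and invTnu: "invertible Tnu"
    using assms by (simp_all add: pos_def_imp_invertible)
  note cancel = matrix_inv_inverse [OF invTx] matrix_inv_inverse [OF invTnu]
  have sym_root: "transpose (mat_sqrt Q) = mat_sqrt Q" and root: "mat_sqrt Q ** mat_sqrt Q = Q"
    using mat_sqrt_diagonal [OF assms(2,3)] by (simp_all add: pos_semidef_def)
  note block_simps = block_matrix_mult transpose_block_matrix block_matrix_add matrix_transpose_mul
    transpose_0 transpose_minus transpose_scalar matrix_mult_minus_left matrix_mult_minus_right
    matrix_mul_assoc scalar_matrix_assoc [symmetric] matrix_scalar_ac cancel
  have X: "pos_def X"
    unfolding pos_def_def
  proof (intro conjI allI impI)
    show "transpose X = X"
      by (simp add: X_def transpose_block_matrix transpose_scalar transpose_0 symTx symTnu)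
    fix v :: "real^('x + 'r)" assume v: "v \<noteq> 0"
    obtain u w where uw: "v = block_vector u w" by (rule block_vector_cases)
    have "0 \<le> u \<bullet> (Tx *v u)" "u \<noteq> 0 \<Longrightarrow> 0 < u \<bullet> (Tx *v u)"
      "0 \<le> w \<bullet> (Tnu *v w)" "w \<noteq> 0 \<Longrightarrow> 0 < w \<bullet> (Tnu *v w)"
      using assms(7,9) by (auto simp: pos_def_def) (metis inner_zero_left less_eq_real_def)+
    moreover have "u \<noteq> 0 \<or> w \<noteq> 0" using v uw block_vector_0 by auto
    ultimately have "0 < u \<bullet> (Tx *v u) + w \<bullet> (Tnu *v w)"
      by (auto intro: add_pos_nonneg add_nonneg_pos)
    then show "0 < v \<bullet> (X *v v)"
      by (simp add: X_def uw block_matrix_mult_vector inner_block_vector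
          flip: scaleR_matrix_vector_assoc)
  qed
  \<comment> \<open>The off-diagonal blocks are skew, so adding the transpose leaves only
    \<open>- Q\<close> in the first block, which \<open>transpose C ** C\<close>
    compensates.\<close>
  have XA: "X ** A = block_matrix ((-1/2) *\<^sub>R Q) ((-1/2) *\<^sub>R transpose S) ((1/2) *\<^sub>R S) 0"
    by (simp add: X_def A_def saddle_A_def block_simps)
  have lyapunov: "transpose A ** X + X ** A + transpose C ** C = 0"
  proof -
    have "transpose A ** X = transpose (X ** A)"
      using X by (simp add: matrix_transpose_mul pos_def_def)
    moreover have "transpose C ** C = block_matrix Q 0 0 0"
      by (simp add: C_def saddle_C_def transpose_block_row_mult transpose_0 sym_root root)
    moreover have "- ((1/2) *\<^sub>R Q) - (1/2) *\<^sub>R Q + Q = 0"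
      by (simp add: vec_eq_iff)
    ultimately show ?thesis
      by (simp add: XA transpose_block_matrix block_matrix_add transpose_0 transpose_minus
          transpose_scalar symQ flip: block_matrix_0)
  qed
  have Cv: "u = 0" if "C *v block_vector u w = 0" for u w
  proof -
    have "mat_sqrt Q *v (mat_sqrt Q *v u) = 0" using that by (simp add: C_def saddle_output)
    then show ?thesis
      using pos_def_mult_vector_eq_0 [OF assms(3)] by (simp add: matrix_vector_mul_assoc root)
  qed
  show hurwitz: "hurwitz A"
  proof (rule hurwitz_if_lyapunov [OF X lyapunov])
    fix v assume v: "C *v v = 0" "C *v (A *v v) = 0"
    obtain u w where uw: "v = block_vector u w" by (rule block_vector_cases)
    have u: "u = 0" using Cv v(1) uw by simp
    \<comment> \<open>Zero output forces the primal part to vanish; the primal part of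
      \<open>A *v v\<close> then sees only \<open>transpose S *v w\<close>, which a second zero
      output annihilates.\<close>
    have "A *v v = block_vector (- (matrix_inv Tx *v (transpose S *v w))) 0"
      by (simp add: A_def saddle_A_def uw u block_matrix_mult_vector uminus_matrix_vector_mult
          flip: matrix_vector_mul_assoc)
    then have "matrix_inv Tx *v (transpose S *v w) = 0" using Cv v(2) by fastforce
    then have "transpose S *v w = 0"
      using invertible_mult_eq_iff [OF invTx, of 0 "transpose S *v w"] by simp
    then have "w = 0" by (rule full_row_rank_transpose_eq_0 [OF assms(4)])
    then show "v = 0" by (simp add: uw u block_vector_0)
  qed
  have "h2_norm_squared A B C = complex_of_real (trace (transpose B ** X ** B))"
    using X by (intro h2_norm_squared_eq_trace hurwitz lyapunov) (simp add: pos_def_def)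
  also have "trace (transpose B ** X ** B)
      = tc\<^sup>2 / 2 * trace (matrix_inv Tx) + tb\<^sup>2 / 2 * trace (transpose Wb ** matrix_inv Tnu ** Wb)"
  proof -
    \<comment> \<open>Here \<open>X\<close> cancels the inverse weights of one copy of
      \<open>B\<close>; the other copy supplies the single inverse in each trace.\<close>
    have "X ** B = block_matrix ((- tc / 2) *\<^sub>R mat 1) 0 0 ((- tb / 2) *\<^sub>R Wb)"
      by (simp add: X_def B_def saddle_B_def block_simps)
    then have "transpose B ** X ** B = block_matrix ((tc\<^sup>2 / 2) *\<^sub>R matrix_inv Tx) 0 0
        ((tb\<^sup>2 / 2) *\<^sub>R (transpose Wb ** matrix_inv Tnu ** Wb))"
      by (simp add: B_def saddle_B_def block_simps power2_eq_square
          transpose_matrix_inv invTx invTnu symTx symTnu flip: matrix_mul_assoc [of _ X])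
    then show ?thesis by (simp add: trace_block_matrix trace_scaleR)
  qed
  finally show "h2_norm_squared A B C = complex_of_real
      (tc\<^sup>2 / 2 * trace (matrix_inv Tx) + tb\<^sup>2 / 2 * trace (transpose Wb ** matrix_inv Tnu ** Wb))" .
qed

end
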